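(* Let $m\ge2$ be an integer. (a) For every $f\in\mathcal F_m$ and all $\lambda,x,y\in[0,1]$ with $x\le y$, $$f(\lambda x+(1-\lambda)y)\le\lambda f(x)+(1-\lambda)f(y)+(y-x)F_m(\lambda).$$ (b) Moreover, if $f:\mathbb R\to\mathbb R$ satisfies $f\big(\frac{x_1+\dots+x_m}{m}\big)\le\frac{f(x_1)+\dots+f(x_m)}{m}+(x_m-x_1)$ for all real $x_1,\dots,x_m$ with $\min_ix_i=x_1$ and $\max_ix_i=x_m$, then the inequality in (a) holds for all real $x\le y$ and all $\lambda\in[0,1]$.
   Context: For an integer $m\ge2$, $\mathcal F_m$ is the class of all functions $f:[0,1]\to\mathbb R$ such that $\max\{f(0),f(1)\}\le0$ and such that for all $x_1,\dots,x_m\in[0,1]$ with $\min_ix_i=x_1$ and $\max_ix_i=x_m$, $f\big(\frac{x_1+\dots+x_m}{m}\big)\le\frac{f(x_1)+\dots+f(x_m)}{m}+(x_m-x_1)$. $F_m:[0,1]\to\mathbb R$ denotes the pointwise maximal element of $\mathcal F_m$, i.e. $F_m(x)=\sup\{f(x): f\in\mathcal F_m\}$ (this function belongs to $\mathcal F_m$).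
   Formalization: F_m is taken as a supremum in the extended reals: it is not real-valued as claimed, since additive functions vanishing at 1 lie in the class and make F_m infinite at every irrational λ, where the inequality then says nothing for x<y; where F_m(λ) is finite the inequality is the stated one. *)

theory Defs
  imports "HOL-Library.Extended_Real"
begin

definition relaxed_convex_on :: "nat \<Rightarrow> real set \<Rightarrow> (real \<Rightarrow> real) \<Rightarrow> bool" where
  "relaxed_convex_on m D f \<longleftrightarrow>
    (\<forall>x :: nat \<Rightarrow> real. (\<forall>i\<in>{1..m}. x i \<in> D) \<longrightarrow>
       Min (x ` {1..m}) = x 1 \<longrightarrow> Max (x ` {1..m}) = x m \<longrightarrow>
       f ((\<Sum>i=1..m. x i) / real m) \<le> (\<Sum>i=1..m. f (x i)) / real m + (x m - x 1))"

text \<open>Functions on the unit interval are represented by total functions whose values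
  outside the interval are irrelevant.\<close>

definition Fclass :: "nat \<Rightarrow> (real \<Rightarrow> real) set" where
  "Fclass m = {f. max (f 0) (f 1) \<le> 0 \<and> relaxed_convex_on m {0..1} f}"

text \<open>The supremum is taken in the extended reals: no regularity is imposed on the members
  of the class, which therefore contains every additive function vanishing at \<open>1\<close>, and the
  supremum is infinite at irrational points (\<open>Fmax_irrational\<close> below).
  The supremum over the reals would be an unspecified value there.\<close>

definition Fmax :: "nat \<Rightarrow> real \<Rightarrow> ereal" where
  "Fmax m x = (SUP f\<in>Fclass m. ereal (f x))"

lemma additive_in_Fclass:
  assumes add: "\<And>a b. f (a + b) = f a + f b" and f1: "f 1 = 0" and m: "m \<ge> 2"
  shows "f \<in> Fclass m"
proof -
  have f0: "f 0 = 0" using add[of 0 0] by simp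
  have fsum: "f (sum g A) = (\<Sum>i\<in>A. f (g i))" if "finite A" for g :: "nat \<Rightarrow> real" and A
    using that by (induction A rule: finite_induct) (auto simp: f0 add)
  have fmul: "f (real n * a) = real n * f a" for n a
    by (induction n) (auto simp: f0 add algebra_simps)
  have "f ((\<Sum>i=1..m. x i) / real m) = (\<Sum>i=1..m. f (x i)) / real m" for x
    using fmul[of m "(\<Sum>i=1..m. x i) / real m"] fsum[of "{1..m}" x] m
    by (simp add: field_simps)
  moreover have "x 1 \<le> x m" if "Min (x ` {1..m}) = x 1" for x :: "nat \<Rightarrow> real"
    using that m by (metis Min_le finite_atLeastAtMost finite_imageI imageI
        atLeastAtMost_iff le_refl one_le_numeral order.trans)
  ultimately show ?thesis
    using f0 f1 by (auto simp: Fclass_def relaxed_convex_on_def)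
qed

lemma Fmax_irrational:
  assumes m: "m \<ge> 2" and x: "x \<notin> \<rat>"
  shows "Fmax m x = \<infinity>"
proof -
  interpret V: vector_space "\<lambda>(q::rat) (a::real). of_rat q * a"
    by unfold_locales (auto simp: algebra_simps of_rat_add of_rat_mult)
  interpret P: vector_space_pair "\<lambda>(q::rat) (a::real). of_rat q * a" "\<lambda>(q::rat) (a::real). of_rat q * a"
    by unfold_locales
  have x1: "x \<noteq> 1" using x by auto
  have "x \<notin> V.span {1}"
    using x by (auto simp: V.span_singleton)
  then have ind: "V.independent {x, 1}"
    using V.independent_insertI[of x "{1}"] V.dependent_single[of 1] by simp
  have "\<exists>f\<in>Fclass m. f x = c" for c
  proof -
    obtain g where g: "Vector_Spaces.linear (\<lambda>(q::rat) (a::real). of_rat q * a) (\<lambda>(q::rat) (a::real). of_rat q * a) g"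
      and gv: "\<forall>a\<in>{x, 1}. g a = (if a = x then c else 0)"
      using P.linear_independent_extend[OF ind, of "\<lambda>a. if a = x then c else 0"] by blast
    have "g (a + b) = g a + g b" for a b
      using g by (simp add: Vector_Spaces.linear_iff)
    then have "g \<in> Fclass m" using additive_in_Fclass[of g m] gv x1 m by auto
    then show ?thesis using gv by auto
  qed
  then have "\<exists>f\<in>Fclass m. ereal (real n) \<le> ereal (f x)" for n
    by (metis order_refl)
  then show ?thesis
    unfolding Fmax_def by (rule SUP_PInfty)
qed

end

theory Submission
  imports Defs "HOL-Combinatorics.Transposition"
begin

text \<open>Subtract from \<open>f\<close> its chord over \<open>[x, y]\<close> and rescale the interval to \<open>[0, 1]\<close>, with \<open>x\<close>
  corresponding to \<open>1\<close> and \<open>y\<close> to \<open>0\<close>; dividing by \<open>y - x\<close> normalises the error term.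
  The result vanishes at both endpoints and belongs to the class, so its value at \<open>\<lambda>\<close>
  is at most \<open>F\<^sub>m \<lambda>\<close>.\<close>

text \<open>Pointwise bounds replace \<open>Min\<close> and \<open>Max\<close>, so the condition can
  be checked directly after a monotone change of variable or a permutation of the points.\<close>

lemma relaxed_convex_on_iff:
  assumes "m \<ge> 1"
  shows "relaxed_convex_on m D f \<longleftrightarrow>
    (\<forall>x. (\<forall>i\<in>{1..m}. x i \<in> D \<and> x 1 \<le> x i \<and> x i \<le> x m) \<longrightarrow>
       f ((\<Sum>i=1..m. x i) / real m) \<le> (\<Sum>i=1..m. f (x i)) / real m + (x m - x 1))"
proof -
  have "Min (x ` {1..m}) = x 1 \<longleftrightarrow> (\<forall>i\<in>{1..m}. x 1 \<le> x i)" for x :: "nat \<Rightarrow> real"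
    using assms by (subst Min_eq_iff) auto
  moreover have "Max (x ` {1..m}) = x m \<longleftrightarrow> (\<forall>i\<in>{1..m}. x i \<le> x m)" for x :: "nat \<Rightarrow> real"
    using assms by (subst Max_eq_iff) auto
  ultimately show ?thesis
    unfolding relaxed_convex_on_def by (simp add: ball_conj_distrib imp_conjL)
qed

text \<open>Affine functions turn means into means exactly, so removing the chord leaves the
  inequality intact, while the rescaling multiplies the spread of the points by
  \<open>y - x\<close>, which the division undoes.\<close>

lemma chord_deviation_in_Fclass:
  assumes m: "m \<ge> 1" and f: "relaxed_convex_on m D f" and D: "{x..y} \<subseteq> D" and "x < y"
  shows "(\<lambda>t. (f (t * x + (1 - t) * y) - (t * f x + (1 - t) * f y)) / (y - x)) \<in> Fclass m"
    (is "?g \<in> _")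
proof -
  define g where "g = ?g"
  define a where "a t = t * x + (1 - t) * y" for t
  define b where "b t = t * f x + (1 - t) * f y" for t
  have f_a: "f (a t) = b t + (y - x) * g t" for t
    using \<open>x < y\<close> by (simp add: g_def a_def b_def)
  \<comment> \<open>Needed twice: with \<open>x\<close>, \<open>y\<close> for the points
    \<open>a (u i)\<close>, and with \<open>f x\<close>, \<open>f y\<close> for the chord values
    \<open>b (u i)\<close>.\<close>
  have mean: "(\<Sum>i=1..m. u i * c + (1 - u i) * d) / real m
      = (\<Sum>i=1..m. u i) / real m * c + (1 - (\<Sum>i=1..m. u i) / real m) * d"
    for u :: "nat \<Rightarrow> real" and c d
    using m by (simp add: sum.distrib sum_subtractf field_simps flip: sum_distrib_left sum_distrib_right)
  have a_diff: "a s - a t = (y - x) * (t - s)" for s t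
    by (simp add: a_def algebra_simps)
  have a_antimono: "a s \<le> a t" if "t \<le> s" for s t
    using a_diff[of t s] mult_nonneg_nonneg[of "y - x" "s - t"] that \<open>x < y\<close> by linarith
  have a_mem: "a t \<in> D" if "t \<in> {0..1}" for t
    using a_antimono[of t 1] a_antimono[of 0 t] that D by (auto simp: a_def)
  have "g ((\<Sum>i=1..m. u i) / real m) \<le> (\<Sum>i=1..m. g (u i)) / real m + (u m - u 1)"
    if u: "\<forall>i\<in>{1..m}. u i \<in> {0..1} \<and> u 1 \<le> u i \<and> u i \<le> u m" for u
  proof -
    let ?M = "(\<Sum>i=1..m. u i) / real m"
    \<comment> \<open>\<open>a\<close> reverses the order, so the first and last points trade places.\<close>
    define v where "v i = a (u (transpose 1 m i))" for i
    have bij: "bij_betw (transpose 1 m) {1..m} {1..m}"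
      using m by (simp add: bij_betw_transpose_iff)
    have v1: "v 1 = a (u m)" and vm: "v m = a (u 1)" by (simp_all add: v_def)
    have "\<forall>i\<in>{1..m}. v i \<in> D \<and> v 1 \<le> v i \<and> v i \<le> v m"
      unfolding v1 vm using u bij a_mem a_antimono by (metis bij_betw_apply v_def)
    then have "f ((\<Sum>i=1..m. v i) / real m) \<le> (\<Sum>i=1..m. f (v i)) / real m + (v m - v 1)"
      using f m by (simp add: relaxed_convex_on_iff)
    \<comment> \<open>The transposition does not change the sum, and by \<open>mean\<close> the
      average of the points \<open>a (u i)\<close> is \<open>a ?M\<close>.\<close>
    moreover have "f ((\<Sum>i=1..m. v i) / real m) = b ?M + (y - x) * g ?M"
      unfolding v_def sum.reindex_bij_betw[OF bij, of "\<lambda>i. a (u i)"]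
      by (simp only: f_a[symmetric]) (simp only: a_def mean)
    moreover have "(\<Sum>i=1..m. f (v i)) / real m = b ?M + (y - x) * ((\<Sum>i=1..m. g (u i)) / real m)"
    proof -
      have "(\<Sum>i=1..m. f (v i)) = (\<Sum>i=1..m. b (u i)) + (y - x) * (\<Sum>i=1..m. g (u i))"
        unfolding v_def sum.reindex_bij_betw[OF bij, of "\<lambda>i. f (a (u i))"]
        by (simp only: f_a sum.distrib sum_distrib_left)
      then show ?thesis
        using mean[of u "f x" "f y"] by (simp add: add_divide_distrib b_def)
    qed
    moreover have "v m - v 1 = (y - x) * (u m - u 1)" by (simp only: v1 vm a_diff)
    \<comment> \<open>The chord value \<open>b ?M\<close> occurs on both sides and cancels; every
      remaining term carries the factor \<open>y - x\<close>.\<close>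
    ultimately have "(y - x) * g ?M \<le> (y - x) * ((\<Sum>i=1..m. g (u i)) / real m + (u m - u 1))"
      unfolding distrib_left by linarith
    then show ?thesis
      using \<open>x < y\<close> by (simp only: mult_le_cancel_left_pos diff_gt_0_iff_gt)
  qed
  moreover have "g 0 = 0" "g 1 = 0" by (simp_all add: g_def)
  ultimately have "g \<in> Fclass m"
    unfolding Fclass_def using m by (simp add: relaxed_convex_on_iff)
  then show ?thesis by (simp only: g_def)
qed

lemma relaxed_convex_on_le_Fmax:
  assumes m: "m \<ge> 1" and f: "relaxed_convex_on m D f" and D: "{x..y} \<subseteq> D" and "x \<le> y"
  shows "ereal (f (l * x + (1 - l) * y))
    \<le> ereal (l * f x + (1 - l) * f y) + ereal (y - x) * Fmax m l"
proof (cases "x = y")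
  case True
  \<comment> \<open>The error term vanishes even if \<open>Fmax m l\<close> is infinite, since zero
    times infinity is zero in \<open>ereal\<close>.\<close>
  then show ?thesis by (simp add: algebra_simps flip: zero_ereal_def)
next
  case False
  then have "x < y" using \<open>x \<le> y\<close> by simp
  let ?g = "\<lambda>t. (f (t * x + (1 - t) * y) - (t * f x + (1 - t) * f y)) / (y - x)"
  have "ereal (?g l) \<le> Fmax m l"
    unfolding Fmax_def by (rule SUP_upper[OF chord_deviation_in_Fclass[OF m f D \<open>x < y\<close>]])
  then have "ereal (y - x) * ereal (?g l) \<le> ereal (y - x) * Fmax m l"
    using \<open>x < y\<close> by (intro ereal_mult_left_mono) auto
  moreover have "ereal (f (l * x + (1 - l) * y))
      = ereal (l * f x + (1 - l) * f y) + ereal (y - x) * ereal (?g l)"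
    using \<open>x < y\<close> by simp
  ultimately show ?thesis by (metis add_left_mono)
qed

theorem theorem8:
  fixes m :: nat
  assumes "m \<ge> 2"
  shows "(\<forall>f\<in>Fclass m. \<forall>l\<in>{0..1::real}. \<forall>x\<in>{0..1::real}. \<forall>y\<in>{0..1::real}. x \<le> y \<longrightarrow>
            ereal (f (l * x + (1 - l) * y))
              \<le> ereal (l * f x + (1 - l) * f y) + ereal (y - x) * Fmax m l) \<and>
         (\<forall>f :: real \<Rightarrow> real. relaxed_convex_on m UNIV f \<longrightarrow>
           (\<forall>l\<in>{0..1::real}. \<forall>x y :: real. x \<le> y \<longrightarrow>
              ereal (f (l * x + (1 - l) * y))
                \<le> ereal (l * f x + (1 - l) * f y) + ereal (y - x) * Fmax m l))"
proof (intro conjI ballI allI impI)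
  fix f and l x y :: real
  assume "f \<in> Fclass m" and "x \<in> {0..1}" "y \<in> {0..1}" and "x \<le> y"
  then show "ereal (f (l * x + (1 - l) * y))
      \<le> ereal (l * f x + (1 - l) * f y) + ereal (y - x) * Fmax m l"
    using assms by (intro relaxed_convex_on_le_Fmax[of m "{0..1}"]) (auto simp: Fclass_def)
next
  fix f and l x y :: real
  assume "relaxed_convex_on m UNIV f" and "x \<le> y"
  then show "ereal (f (l * x + (1 - l) * y))
      \<le> ereal (l * f x + (1 - l) * f y) + ereal (y - x) * Fmax m l"
    using assms by (intro relaxed_convex_on_le_Fmax[of m UNIV]) auto
qed

end
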